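(* Let $k$ be a field of characteristic zero, let $B$ be an integral domain containing $k$, and let $D\in\mathrm{LND}(B)$ be non-zero. If there exists a non-zero $E\in\mathrm{LND}(B)$ such that $DE=ED$ and $\ker(D)\neq\ker(E)$, then $\ker(D)$ is non-rigid.
   Context: $\mathrm{LND}(B)$ is the set of locally nilpotent derivations of $B$: derivations $D$ such that for every $b\in B$ there is a positive integer $m$ with $D^m(b)=0$. A domain containing $k$ is rigid if it has no non-zero locally nilpotent derivation, and non-rigid otherwise. *)

theory Defs
  imports "HOL-Algebra.Algebra"
begin

definition char_zero :: "('a, 'm) ring_scheme \<Rightarrow> bool" where
  "char_zero R \<longleftrightarrow> (\<forall>n::nat. n > 0 \<longrightarrow> [n] \<cdot>\<^bsub>R\<^esub> \<one>\<^bsub>R\<^esub> \<noteq> \<zero>\<^bsub>R\<^esub>)"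

text \<open>
  As for homomorphisms in the library, only the values on the carrier matter. No linearity over
  a base field is required: a locally nilpotent derivation of a domain of characteristic zero
  annihilates all units, hence is automatically linear over every subfield.
\<close>
definition derivation :: "('a, 'm) ring_scheme \<Rightarrow> ('a \<Rightarrow> 'a) \<Rightarrow> bool" where
  "derivation R D \<longleftrightarrow>
     D \<in> carrier R \<rightarrow> carrier R \<and>
     (\<forall>a\<in>carrier R. \<forall>b\<in>carrier R. D (a \<oplus>\<^bsub>R\<^esub> b) = D a \<oplus>\<^bsub>R\<^esub> D b) \<and>
     (\<forall>a\<in>carrier R. \<forall>b\<in>carrier R.
        D (a \<otimes>\<^bsub>R\<^esub> b) = (D a \<otimes>\<^bsub>R\<^esub> b) \<oplus>\<^bsub>R\<^esub> (a \<otimes>\<^bsub>R\<^esub> D b))"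

definition LND :: "('a, 'm) ring_scheme \<Rightarrow> ('a \<Rightarrow> 'a) set" where
  "LND R = {D. derivation R D \<and> (\<forall>b\<in>carrier R. \<exists>m::nat. m > 0 \<and> (D ^^ m) b = \<zero>\<^bsub>R\<^esub>)}"

definition nonzero_map :: "('a, 'm) ring_scheme \<Rightarrow> ('a \<Rightarrow> 'a) \<Rightarrow> bool" where
  "nonzero_map R D \<longleftrightarrow> (\<exists>b\<in>carrier R. D b \<noteq> \<zero>\<^bsub>R\<^esub>)"

text \<open>
  Both notions apply to domains containing \<open>k\<close> only, so this is part of each definition;
  in particular \<open>non_rigid k R\<close> is stronger than \<open>\<not> rigid k R\<close>.
\<close>
definition rigid :: "'a set \<Rightarrow> ('a, 'm) ring_scheme \<Rightarrow> bool" where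
  "rigid k R \<longleftrightarrow> domain R \<and> subfield k R \<and> \<not> (\<exists>D\<in>LND R. nonzero_map R D)"

definition non_rigid :: "'a set \<Rightarrow> ('a, 'm) ring_scheme \<Rightarrow> bool" where
  "non_rigid k R \<longleftrightarrow> domain R \<and> subfield k R \<and> \<not> rigid k R"

end

theory Submission
  imports Defs
begin

text \<open>
  Write \<open>A\<close> for the kernel of \<open>D\<close>. Since \<open>E\<close> commutes with \<open>D\<close>, it maps \<open>A\<close> into itself, and its
  restriction to \<open>A\<close> is a locally nilpotent derivation of \<open>A\<close>. The point is that this restriction
  is non-zero.

  Suppose it is zero, so that \<open>A\<close> is contained in the kernel of \<open>E\<close>. As the two kernels differ,
  there is \<open>b\<close> with \<open>E b = 0\<close> and \<open>D b \<noteq> 0\<close>. Applying \<open>D\<close> to \<open>b\<close> until the last moment gives a local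
  slice of \<open>D\<close>: an element \<open>s\<close> with \<open>D s \<noteq> 0\<close> and \<open>D (D s) = 0\<close>. It is again killed by \<open>E\<close>, because
  \<open>E\<close> commutes with \<open>D\<close>. Now every element of the ring is algebraic over \<open>A[s]\<close>, on which \<open>E\<close>
  vanishes, so \<open>E = 0\<close>. The lemma \<open>vanishes_if_kills_kernel_and_slice\<close> carries out this last step
  as an induction on the \<open>D\<close>-degree, where the degree of \<open>x\<close> is the largest \<open>n\<close> with
  \<open>(D ^^ n) x \<noteq> 0\<close>.

  It remains to see that \<open>A\<close> is a domain containing \<open>k\<close>. The top-degree part of the Leibniz formula
  (\<open>Leibniz_top\<close>) shows that degrees add under multiplication. Hence \<open>A\<close> is factorially closed,
  and in particular it contains all units.
\<close>

section \<open>Derivations of a domain and their kernels\<close>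

locale ring_derivation = domain R for R (structure) +
  fixes D
  assumes derivation: "derivation R D"
begin

lemma D_closed [simp, intro]: "x \<in> carrier R \<Longrightarrow> D x \<in> carrier R"
  using derivation by (auto simp: derivation_def)

lemma D_add: "x \<in> carrier R \<Longrightarrow> y \<in> carrier R \<Longrightarrow> D (x \<oplus> y) = D x \<oplus> D y"
  using derivation by (auto simp: derivation_def)

lemma D_mult:
  "x \<in> carrier R \<Longrightarrow> y \<in> carrier R \<Longrightarrow> D (x \<otimes> y) = D x \<otimes> y \<oplus> x \<otimes> D y"
  using derivation by (auto simp: derivation_def)

lemma D_zero [simp]: "D \<zero> = \<zero>"
  using D_add[of \<zero> \<zero>] by (simp add: add.l_cancel_one)

lemma D_one [simp]: "D \<one> = \<zero>"
  using D_mult[of \<one> \<one>] by (simp add: add.l_cancel_one)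

lemma D_minus: "x \<in> carrier R \<Longrightarrow> D (\<ominus> x) = \<ominus> D x"
  using D_add[of "\<ominus> x" x] by (simp add: l_neg minus_equality)

lemma D_diff: "x \<in> carrier R \<Longrightarrow> y \<in> carrier R \<Longrightarrow> D (x \<ominus> y) = D x \<ominus> D y"
  by (simp add: a_minus_def D_add D_minus)

lemma D_add_pow: "x \<in> carrier R \<Longrightarrow> D ([(n::nat)] \<cdot> x) = [n] \<cdot> D x"
  by (induction n) (simp_all add: D_add)

lemma iter_closed [simp, intro]: "x \<in> carrier R \<Longrightarrow> (D ^^ n) x \<in> carrier R"
  by (induction n) auto

lemma iter_zero [simp]: "(D ^^ n) \<zero> = \<zero>"
  by (induction n) auto

lemma iter_add:
  "x \<in> carrier R \<Longrightarrow> y \<in> carrier R \<Longrightarrow> (D ^^ n) (x \<oplus> y) = (D ^^ n) x \<oplus> (D ^^ n) y"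
  by (induction n) (simp_all add: D_add)

lemma iter_diff:
  "x \<in> carrier R \<Longrightarrow> y \<in> carrier R \<Longrightarrow> (D ^^ n) (x \<ominus> y) = (D ^^ n) x \<ominus> (D ^^ n) y"
  by (induction n) (simp_all add: D_diff)

lemma iter_add_pow: "x \<in> carrier R \<Longrightarrow> (D ^^ n) ([(m::nat)] \<cdot> x) = [m] \<cdot> (D ^^ n) x"
  by (induction n) (simp_all add: D_add_pow)

lemma iter_mult_const:
  assumes "c \<in> carrier R" "x \<in> carrier R" "D c = \<zero>"
  shows "(D ^^ n) (c \<otimes> x) = c \<otimes> (D ^^ n) x"
  using assms by (induction n) (simp_all add: D_mult)

lemma kernel_eq: "a_kernel R R D = {x \<in> carrier R. D x = \<zero>}"
  by (simp add: a_kernel_def')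

lemma kernel_subring: "subring (a_kernel R R D) R"
  by (rule subringI) (auto simp: kernel_eq D_minus D_mult D_add)

lemma domain_kernel: "domain (R\<lparr>carrier := a_kernel R R D\<rparr>)"
  using kernel_subring subring_is_domain by blast

end

section \<open>Degrees with respect to a locally nilpotent derivation\<close>

locale locally_nilpotent_derivation = ring_derivation +
  assumes locally_nilpotent: "x \<in> carrier R \<Longrightarrow> \<exists>n. (D ^^ n) x = \<zero>"
    and char_zero: "char_zero R"
begin

lemma add_pow_nonzero:
  assumes "x \<in> carrier R" "x \<noteq> \<zero>" "n > (0::nat)"
  shows "[n] \<cdot> x \<noteq> \<zero>"
proof -
  have "[n] \<cdot> x = ([n] \<cdot> \<one>) \<otimes> x"
    using assms by (simp add: add_pow_ldistr)
  then show ?thesis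
    using assms char_zero integral[of "[n] \<cdot> \<one>" x] by (auto simp: char_zero_def)
qed

lemma degree_exists:
  assumes "x \<in> carrier R" "x \<noteq> \<zero>"
  obtains n where "(D ^^ n) x \<noteq> \<zero>" "(D ^^ Suc n) x = \<zero>"
proof -
  obtain m where "(D ^^ m) x = \<zero>"
    using locally_nilpotent assms by blast
  then show ?thesis
    using assms that by (induction m) auto
qed

text \<open>
  In the Leibniz formula for \<open>(D ^^ (n + m)) (x \<otimes> y)\<close> every other term contains too high a
  power of \<open>D\<close>, applied either to \<open>x\<close> or to \<open>y\<close>. The degree bounds descend from \<open>x\<close> to \<open>D x\<close> and
  from \<open>y\<close> to \<open>D y\<close>, so Pascal's rule proves the surviving term without the full formula.
\<close>
lemma Leibniz_top:
  assumes "x \<in> carrier R" "y \<in> carrier R" "(D ^^ Suc n) x = \<zero>" "(D ^^ Suc m) y = \<zero>"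
  shows "(D ^^ (n + m)) (x \<otimes> y) = [((n + m) choose n)] \<cdot> ((D ^^ n) x \<otimes> (D ^^ m) y)"
  using assms
proof (induction "n + m" arbitrary: n m x y rule: less_induct)
  case less
  consider "n = 0" | "m = 0" | n' m' where "n = Suc n'" "m = Suc m'"
    by (metis not0_implies_Suc)
  then show ?case
  proof cases
    case 1
    then show ?thesis
      using less.prems by (simp add: iter_mult_const)
  next
    case 2
    then show ?thesis
      using less.prems iter_mult_const[of y x n] by (simp add: m_comm)
  next
    case 3
    let ?t = "(D ^^ n) x \<otimes> (D ^^ m) y"
    have "(D ^^ (n' + m)) (D x \<otimes> y) = [((n' + m) choose n')] \<cdot> ((D ^^ n') (D x) \<otimes> (D ^^ m) y)"
      using less.prems 3 by (intro less.hyps) (simp_all add: funpow_swap1)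
    then have 1: "(D ^^ (n' + m)) (D x \<otimes> y) = [((n' + m) choose n')] \<cdot> ?t"
      using 3 by (simp add: funpow_swap1)
    have "(D ^^ (n + m')) (x \<otimes> D y) = [((n + m') choose n)] \<cdot> ((D ^^ n) x \<otimes> (D ^^ m') (D y))"
      using less.prems 3 by (intro less.hyps) (simp_all add: funpow_swap1)
    then have 2: "(D ^^ (n' + m)) (x \<otimes> D y) = [((n' + m) choose n)] \<cdot> ?t"
      using 3 by (simp add: funpow_swap1)
    have "(D ^^ (n + m)) (x \<otimes> y) = (D ^^ (n' + m)) (D (x \<otimes> y))"
      using 3 by (simp add: funpow_swap1)
    also have "\<dots> = [((n' + m) choose n')] \<cdot> ?t \<oplus> [((n' + m) choose n)] \<cdot> ?t"
      using less.prems 1 2 by (simp add: D_mult iter_add)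
    also have "\<dots> = [((n + m) choose n)] \<cdot> ?t"
      using less.prems 3 by (simp add: add.nat_pow_mult)
    finally show ?thesis .
  qed
qed

text \<open>
  If \<open>x\<close> and \<open>y\<close> have degrees \<open>n\<close> and \<open>m\<close>, then \<open>Leibniz_top\<close> gives \<open>x \<otimes> y\<close> the degree \<open>n + m\<close>,
  since a binomial coefficient is non-zero in characteristic zero. So \<open>n + m = 0\<close> forces \<open>n = 0\<close>.
\<close>
lemma kernel_factorially_closed:
  assumes "x \<in> carrier R" "y \<in> carrier R" "x \<otimes> y \<noteq> \<zero>" "D (x \<otimes> y) = \<zero>"
  shows "D x = \<zero>"
proof -
  have nz: "x \<noteq> \<zero>" "y \<noteq> \<zero>"
    using assms by auto
  obtain n where n: "(D ^^ n) x \<noteq> \<zero>" "(D ^^ Suc n) x = \<zero>"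
    using degree_exists assms(1) nz(1) by blast
  obtain m where m: "(D ^^ m) y \<noteq> \<zero>" "(D ^^ Suc m) y = \<zero>"
    using degree_exists assms(2) nz(2) by blast
  have "(D ^^ n) x \<otimes> (D ^^ m) y \<noteq> \<zero>"
    using assms n m integral by blast
  then have "(D ^^ (n + m)) (x \<otimes> y) \<noteq> \<zero>"
    using Leibniz_top[of x y n m] assms n m by (simp add: add_pow_nonzero)
  moreover have "(D ^^ Suc j) (x \<otimes> y) = \<zero>" for j
    using assms(4) by (simp add: funpow_swap1)
  ultimately have "n = 0"
    by (cases "n + m") auto
  then show ?thesis
    using n by simp
qed

section \<open>Derivations vanishing on the kernel\<close>

text \<open>
  With \<open>a = D s\<close>, the element \<open>[n] \<cdot> (a \<otimes> x) \<ominus> s \<otimes> D x\<close> has smaller degree than an \<open>x\<close> of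
  degree \<open>n > 0\<close>: by \<open>Leibniz_top\<close> the two leading terms cancel. By induction \<open>E\<close> kills this
  element and \<open>D x\<close>; as it also kills \<open>a\<close> and \<open>s\<close>, what is left is \<open>[n] \<cdot> (a \<otimes> E x) = \<zero>\<close>.
\<close>
lemma vanishes_if_kills_kernel_and_slice:
  assumes E: "ring_derivation R E"
    and ker: "\<And>x. x \<in> carrier R \<Longrightarrow> D x = \<zero> \<Longrightarrow> E x = \<zero>"
    and s: "s \<in> carrier R" "D s \<noteq> \<zero>" "D (D s) = \<zero>" "E s = \<zero>"
    and x: "x \<in> carrier R"
  shows "E x = \<zero>"
proof -
  interpret E: ring_derivation R E by fact
  have "E x = \<zero>" if "x \<in> carrier R" "(D ^^ Suc n) x = \<zero>" for n x
    using that
  proof (induction n arbitrary: x)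
    case 0
    then show ?case
      using ker by simp
  next
    case (Suc n)
    define y where "y = [(Suc n)] \<cdot> (D s \<otimes> x) \<ominus> s \<otimes> D x"
    have y: "y \<in> carrier R"
      using Suc.prems s by (simp add: y_def del: add.nat_pow_Suc)
    have Dx: "(D ^^ Suc n) (D x) = \<zero>"
      using Suc.prems by (simp add: funpow_swap1)
    have "(D ^^ Suc n) ([(Suc n)] \<cdot> (D s \<otimes> x)) = [(Suc n)] \<cdot> (D s \<otimes> (D ^^ Suc n) x)"
      using Suc.prems s
      by (simp add: iter_add_pow iter_mult_const del: add.nat_pow_Suc funpow.simps)
    moreover have "(D ^^ Suc n) (s \<otimes> D x) = [(Suc n)] \<cdot> (D s \<otimes> (D ^^ Suc n) x)"
      using Leibniz_top[of s "D x" 1 n] Suc.prems s Dx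
      by (simp add: funpow_swap1 del: add.nat_pow_Suc)
    ultimately have "(D ^^ Suc n) y = \<zero>"
      using Suc.prems s
      by (simp add: y_def iter_diff r_right_minus_eq del: add.nat_pow_Suc funpow.simps)
    then have "E y = \<zero>"
      using Suc.IH y by blast
    moreover have "E (D x) = \<zero>"
      using Suc.IH Suc.prems Dx by blast
    moreover have "E (D s) = \<zero>"
      using ker s by blast
    moreover have "E y = [(Suc n)] \<cdot> E (D s \<otimes> x) \<ominus> E (s \<otimes> D x)"
      using Suc.prems s by (simp add: y_def E.D_diff E.D_add_pow del: add.nat_pow_Suc)
    ultimately have "[(Suc n)] \<cdot> (D s \<otimes> E x) = \<zero>"
      using Suc.prems s by (simp add: E.D_mult a_minus_def del: add.nat_pow_Suc)
    then have "D s \<otimes> E x = \<zero>"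
      using add_pow_nonzero[of "D s \<otimes> E x" "Suc n"] Suc.prems s by blast
    then show ?case
      using integral Suc.prems s by blast
  qed
  moreover obtain n where "(D ^^ n) x = \<zero>"
    using locally_nilpotent x by blast
  moreover from this have "(D ^^ Suc n) x = \<zero>"
    by simp
  ultimately show ?thesis
    using x by blast
qed

text \<open>
  The slice is the last non-constant element among the iterates of \<open>D\<close> at \<open>b\<close>; commutation
  keeps all of them in the kernel of \<open>E\<close>.
\<close>
lemma commuting_vanishes_if_larger_kernel:
  assumes E: "ring_derivation R E"
    and comm: "\<And>x. x \<in> carrier R \<Longrightarrow> D (E x) = E (D x)"
    and ker: "\<And>x. x \<in> carrier R \<Longrightarrow> D x = \<zero> \<Longrightarrow> E x = \<zero>"
    and b: "b \<in> carrier R" "E b = \<zero>" "D b \<noteq> \<zero>"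
    and x: "x \<in> carrier R"
  shows "E x = \<zero>"
proof -
  interpret E: ring_derivation R E by fact
  obtain n where n: "(D ^^ n) (D b) \<noteq> \<zero>" "(D ^^ Suc n) (D b) = \<zero>"
    using degree_exists b by blast
  have "E ((D ^^ j) b) = \<zero>" for j
    using b by (induction j) (simp_all flip: comm)
  then show ?thesis
    using vanishes_if_kills_kernel_and_slice[OF E ker, of "(D ^^ n) b"] b n x
    by (simp add: funpow_swap1)
qed

section \<open>Subfields lie in the kernel\<close>

lemma subfield_subset_kernel:
  assumes "subfield k R"
  shows "k \<subseteq> a_kernel R R D"
proof
  fix u assume u: "u \<in> k"
  show "u \<in> a_kernel R R D"
  proof (cases "u = \<zero>")
    case True
    then show ?thesis by (simp add: kernel_eq)
  next
    case False
    then have "u \<in> carrier R" "inv u \<in> carrier R" "u \<otimes> inv u = \<one>"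
      using subfield_m_inv[OF assms, of u] u subfieldE(3)[OF assms] by auto
    then show ?thesis
      using kernel_factorially_closed[of u "inv u"] by (simp add: kernel_eq)
  qed
qed

lemma subfield_kernel:
  assumes "subfield k R"
  shows "subfield k (R\<lparr>carrier := a_kernel R R D\<rparr>)"
proof -
  interpret A: domain "R\<lparr>carrier := a_kernel R R D\<rparr>"
    by (rule domain_kernel)
  show ?thesis
    using A.subfield_iff(1)[of k] subfield_iff(2)[OF assms] subfield_subset_kernel[OF assms]
    by simp
qed

end

section \<open>Non-rigidity of the kernel\<close>

lemma restrict_LND:
  assumes "E \<in> LND R" "subring A R" "E \<in> A \<rightarrow> A"
  shows "E \<in> LND (R\<lparr>carrier := A\<rparr>)"
proof -
  have "A \<subseteq> carrier R"
    using assms(2) by (rule subringE(1))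
  then show ?thesis
    using assms by (auto simp: LND_def derivation_def subset_iff)
qed

lemma char_zero_carrier_update: "char_zero (R\<lparr>carrier := A\<rparr>) \<longleftrightarrow> char_zero R"
  by (simp add: char_zero_def add_pow_def nat_pow_def)

theorem proposition4p5:
  fixes B :: "('a, 'm) ring_scheme" and k :: "'a set" and D :: "'a \<Rightarrow> 'a"
  assumes "domain B"
    and "subfield k B"
    and "char_zero (B\<lparr>carrier := k\<rparr>)"
    and "D \<in> LND B"
    and "nonzero_map B D"
    and "\<exists>E\<in>LND B. nonzero_map B E
           \<and> (\<forall>b\<in>carrier B. D (E b) = E (D b))
           \<and> a_kernel B B D \<noteq> a_kernel B B E"
  shows "non_rigid k (B\<lparr>carrier := a_kernel B B D\<rparr>)"
proof -
  obtain E where E: "E \<in> LND B" "nonzero_map B E" "\<And>b. b \<in> carrier B \<Longrightarrow> D (E b) = E (D b)"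
    "a_kernel B B D \<noteq> a_kernel B B E"
    using assms(6) by auto
  have char: "char_zero B"
    using assms(3) by (simp add: char_zero_carrier_update)
  interpret D: locally_nilpotent_derivation B D
    using assms char
    by (auto simp: locally_nilpotent_derivation_def locally_nilpotent_derivation_axioms_def
        ring_derivation_def ring_derivation_axioms_def LND_def)
  interpret E: ring_derivation B E
    using assms E by (auto simp: ring_derivation_def ring_derivation_axioms_def LND_def)
  let ?A = "a_kernel B B D"
  have "E \<in> LND (B\<lparr>carrier := ?A\<rparr>)"
    using E D.kernel_subring by (intro restrict_LND) (auto simp: D.kernel_eq)
  moreover have "nonzero_map (B\<lparr>carrier := ?A\<rparr>) E"
  proof (rule ccontr)
    assume "\<not> ?thesis"
    then have ker: "E x = \<zero>\<^bsub>B\<^esub>" if "x \<in> carrier B" "D x = \<zero>\<^bsub>B\<^esub>" for x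
      using that by (auto simp: nonzero_map_def D.kernel_eq)
    then obtain b where "b \<in> carrier B" "E b = \<zero>\<^bsub>B\<^esub>" "D b \<noteq> \<zero>\<^bsub>B\<^esub>"
      using E(4) by (auto simp: D.kernel_eq E.kernel_eq)
    then have "E x = \<zero>\<^bsub>B\<^esub>" if "x \<in> carrier B" for x
      using D.commuting_vanishes_if_larger_kernel[of E b x] E.ring_derivation_axioms
        E(3) ker that by blast
    then show False
      using E(2) by (auto simp: nonzero_map_def)
  qed
  ultimately show ?thesis
    using D.domain_kernel D.subfield_kernel[OF assms(2)] by (auto simp: non_rigid_def rigid_def)
qed

end
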